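(* An implicative-orthomodular algebra is a quantum-Wajsberg algebra if and only if it is a meta-Wajsberg algebra.
   Context: A BE algebra is an algebra $(X,\to,1)$ of type $(2,0)$ such that for all $x,y,z\in X$: $x\to x=1$; $x\to 1=1$; $1\to x=x$; $x\to (y\to z)=y\to (x\to z)$. Write $x\le y$ iff $x\to y=1$. It is bounded if there is $0\in X$ with $0\le x$ for all $x\in X$; then $x^*:=x\to 0$. It is involutive if it is bounded and $x^{**}=x$ for all $x\in X$; an involutive BE algebra is denoted $(X,\to,^*,1)$. In an involutive BE algebra define $x\Cap y=((x^*\to y^* )\to y^* )^*$. An involutive BE algebra $X$ is called: - implicative-orthomodular if $x\to (y\Cap (z\Cap x))=(x\to y)\Cap (x\to z)$ for all $x,y,z\in X$; - meta-Wajsberg if $(x\Cap y)\to (y\Cap x)=1$ for all $x,y\in X$; - quantum-Wajsberg if $x\to ((x\Cap y)\Cap (z\Cap x))=(x\to y)\Cap (x\to z)$ for all $x,y,z\in X$; equivalently (known), if both $x\to (x\Cap y)=x\to y$ and $x\to (y\Cap (z\Cap x))=(x\to y)\Cap (x\to z)$ hold for all $x,y,z\in X$. *)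

theory Defs
  imports Main
begin

locale be_algebra =
  fixes X :: "'a set"
    and imp :: "'a \<Rightarrow> 'a \<Rightarrow> 'a" (infixr "\<rightarrow>" 60)
    and one :: 'a ("\<one>")
  assumes imp_closed: "\<lbrakk>x \<in> X; y \<in> X\<rbrakk> \<Longrightarrow> x \<rightarrow> y \<in> X"
    and one_closed: "\<one> \<in> X"
    and imp_refl: "x \<in> X \<Longrightarrow> x \<rightarrow> x = \<one>"
    and imp_one: "x \<in> X \<Longrightarrow> x \<rightarrow> \<one> = \<one>"
    and one_imp: "x \<in> X \<Longrightarrow> \<one> \<rightarrow> x = x"
    and imp_exchange: "\<lbrakk>x \<in> X; y \<in> X; z \<in> X\<rbrakk> \<Longrightarrow> x \<rightarrow> (y \<rightarrow> z) = y \<rightarrow> (x \<rightarrow> z)"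
begin

definition le :: "'a \<Rightarrow> 'a \<Rightarrow> bool" (infix "\<preceq>" 50)
  where "x \<preceq> y \<longleftrightarrow> x \<rightarrow> y = \<one>"

end

text \<open>
  In a BE algebra \<open>\<preceq>\<close> need not be antisymmetric, so a least element need not be unique;
  the element \<open>0\<close> on which the complement depends is therefore a parameter of the structure.
\<close>

locale bounded_be_algebra = be_algebra X imp one
  for X :: "'a set"
    and imp :: "'a \<Rightarrow> 'a \<Rightarrow> 'a" (infixr "\<rightarrow>" 60)
    and zero :: 'a ("\<zero>")
    and one :: 'a ("\<one>") +
  assumes zero_closed: "\<zero> \<in> X"
    and zero_le: "x \<in> X \<Longrightarrow> \<zero> \<preceq> x"
begin

definition neg :: "'a \<Rightarrow> 'a" ("_\<^sup>\<star>" [1000] 999)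
  where "x\<^sup>\<star> = x \<rightarrow> \<zero>"

end

locale involutive_be_algebra = bounded_be_algebra +
  assumes neg_neg: "x \<in> X \<Longrightarrow> (x\<^sup>\<star>)\<^sup>\<star> = x"
begin

text \<open>
  The operation usually written with a double cap. It is in general neither commutative nor
  associative, and it is not the infimum of \<open>\<preceq>\<close>.
\<close>

definition cap :: "'a \<Rightarrow> 'a \<Rightarrow> 'a" (infixl "\<sqinter>" 70)
  where "x \<sqinter> y = ((x\<^sup>\<star> \<rightarrow> y\<^sup>\<star>) \<rightarrow> y\<^sup>\<star>)\<^sup>\<star>"

end

locale implicative_orthomodular_algebra = involutive_be_algebra +
  assumes implicative_orthomodular:
    "\<lbrakk>x \<in> X; y \<in> X; z \<in> X\<rbrakk> \<Longrightarrow> x \<rightarrow> (y \<sqinter> (z \<sqinter> x)) = (x \<rightarrow> y) \<sqinter> (x \<rightarrow> z)"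

locale meta_wajsberg_algebra = involutive_be_algebra +
  assumes meta_wajsberg:
    "\<lbrakk>x \<in> X; y \<in> X\<rbrakk> \<Longrightarrow> (x \<sqinter> y) \<rightarrow> (y \<sqinter> x) = \<one>"

locale quantum_wajsberg_algebra = involutive_be_algebra +
  assumes quantum_wajsberg:
    "\<lbrakk>x \<in> X; y \<in> X; z \<in> X\<rbrakk> \<Longrightarrow> x \<rightarrow> ((x \<sqinter> y) \<sqinter> (z \<sqinter> x)) = (x \<rightarrow> y) \<sqinter> (x \<rightarrow> z)"

end

(* In an involutive BE algebra, x \<sqinter> y is the product of y and y \<rightarrow> x for the commutative product
   x \<cdot> y = (x \<rightarrow> y\<^sup>\<star>)\<^sup>\<star>; residuation then gives (x \<sqinter> y) \<rightarrow> z = (y \<rightarrow> x) \<rightarrow> (y \<rightarrow> z).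
   Under implicative-orthomodularity, both properties in question are equivalent to the law
   x \<rightarrow> (x \<sqinter> y) = x \<rightarrow> y. The hard part is to get this law from the meta-Wajsberg property: with
   p = x \<sqinter> y, u = x \<rightarrow> y and v = x \<rightarrow> p, the orthomodular identity gives u = v \<sqinter> u as soon as
   (y \<sqinter> x) \<rightarrow> p = \<one>, while y = (y \<rightarrow> x) \<rightarrow> p turns u into (y \<rightarrow> x) \<rightarrow> v, so that v \<sqinter> u = v. *)
theory Submission
  imports Defs
begin

context involutive_be_algebra
begin

lemma neg_closed: "x \<in> X \<Longrightarrow> x\<^sup>\<star> \<in> X"
  by (simp add: neg_def imp_closed zero_closed)

lemma cap_closed: "\<lbrakk>x \<in> X; y \<in> X\<rbrakk> \<Longrightarrow> x \<sqinter> y \<in> X"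
  by (simp add: cap_def neg_closed imp_closed)

lemmas closed = imp_closed neg_closed cap_closed zero_closed one_closed

lemma imp_neg_commute: "\<lbrakk>x \<in> X; y \<in> X\<rbrakk> \<Longrightarrow> x \<rightarrow> y\<^sup>\<star> = y \<rightarrow> x\<^sup>\<star>"
  unfolding neg_def by (simp add: imp_exchange zero_closed)

lemma neg_imp_neg: "\<lbrakk>x \<in> X; y \<in> X\<rbrakk> \<Longrightarrow> x\<^sup>\<star> \<rightarrow> y\<^sup>\<star> = y \<rightarrow> x"
  using imp_neg_commute[of "x\<^sup>\<star>" y] by (simp add: closed neg_neg)

lemma neg_one: "\<one>\<^sup>\<star> = \<zero>"
  by (simp add: neg_def one_imp zero_closed)

lemma cap_eq: "\<lbrakk>x \<in> X; y \<in> X\<rbrakk> \<Longrightarrow> x \<sqinter> y = (y \<rightarrow> (y \<rightarrow> x)\<^sup>\<star>)\<^sup>\<star>"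
  by (simp add: cap_def neg_imp_neg imp_neg_commute[of "y \<rightarrow> x" y] closed)

text \<open>Contraposition removes the outer negation in \<open>cap_eq\<close>; exchange and a
  second contraposition then restore \<open>z\<close>.\<close>

lemma cap_imp:
  assumes [simp]: "x \<in> X" "y \<in> X" "z \<in> X"
  shows "(x \<sqinter> y) \<rightarrow> z = (y \<rightarrow> x) \<rightarrow> (y \<rightarrow> z)"
proof -
  have "(x \<sqinter> y) \<rightarrow> z = z\<^sup>\<star> \<rightarrow> (y \<rightarrow> (y \<rightarrow> x)\<^sup>\<star>)"
    using neg_imp_neg[of "y \<rightarrow> (y \<rightarrow> x)\<^sup>\<star>" "z\<^sup>\<star>"] by (simp add: cap_eq closed neg_neg)
  also have "\<dots> = y \<rightarrow> ((y \<rightarrow> x) \<rightarrow> z)"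
    by (simp add: imp_exchange[of "z\<^sup>\<star>"] neg_imp_neg closed)
  finally show ?thesis
    by (simp add: imp_exchange closed)
qed

lemma one_cap: "x \<in> X \<Longrightarrow> \<one> \<sqinter> x = x"
  by (simp add: cap_eq imp_one neg_one one_closed flip: neg_def) (simp add: neg_neg)

lemma cap_one: "x \<in> X \<Longrightarrow> x \<sqinter> \<one> = x"
  by (simp add: cap_eq one_imp neg_neg closed)

lemma zero_cap: "x \<in> X \<Longrightarrow> \<zero> \<sqinter> x = \<zero>"
  by (simp add: cap_eq closed neg_neg imp_refl neg_one flip: neg_def)

lemma cap_eq_right: "\<lbrakk>x \<in> X; y \<in> X; y \<rightarrow> x = \<one>\<rbrakk> \<Longrightarrow> x \<sqinter> y = y"
  by (simp add: cap_eq neg_one flip: neg_def) (simp add: neg_neg)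

end

context implicative_orthomodular_algebra
begin

text \<open>The choice \<open>z = \<one>\<close> collapses the orthomodular identity, since
  \<open>\<one>\<close> is a two-sided unit for \<open>\<sqinter>\<close>.\<close>

lemma imp_cap: "\<lbrakk>x \<in> X; y \<in> X\<rbrakk> \<Longrightarrow> x \<rightarrow> (y \<sqinter> x) = x \<rightarrow> y"
  using implicative_orthomodular[of x y \<one>]
  by (simp add: one_cap cap_one imp_one closed)

text \<open>The choice \<open>y = \<zero>\<close> reduces the left side of the orthomodular identity
  to \<open>x \<rightarrow> \<zero>\<close>.\<close>

lemma neg_cap_imp: "\<lbrakk>x \<in> X; z \<in> X\<rbrakk> \<Longrightarrow> x\<^sup>\<star> \<sqinter> (x \<rightarrow> z) = x\<^sup>\<star>"
  using implicative_orthomodular[of x \<zero> z]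
  by (simp add: zero_cap closed flip: neg_def)

lemma cap_imp_cancel: "\<lbrakk>x \<in> X; z \<in> X\<rbrakk> \<Longrightarrow> x \<sqinter> (z \<rightarrow> x) = x"
  using neg_cap_imp[of "x\<^sup>\<star>" "z\<^sup>\<star>"] by (simp add: neg_imp_neg neg_neg closed)

lemma imp_imp_cap:
  assumes [simp]: "x \<in> X" "z \<in> X"
  shows "(x \<rightarrow> z) \<rightarrow> (z \<sqinter> x) = x"
proof -
  let ?w = "x \<rightarrow> z"
  \<comment> \<open>This is \<open>neg_cap_imp\<close> expanded; moving the negation inside exposes
    \<open>z \<sqinter> x\<close> in the form of \<open>cap_eq\<close>.\<close>
  have "(?w \<rightarrow> (x \<rightarrow> ?w\<^sup>\<star>)\<^sup>\<star>)\<^sup>\<star> = x\<^sup>\<star>"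
    using neg_cap_imp[of x z] by (simp add: cap_eq closed imp_neg_commute[of ?w x])
  then have "((?w \<rightarrow> (z \<sqinter> x))\<^sup>\<star>)\<^sup>\<star> = (x\<^sup>\<star>)\<^sup>\<star>"
    by (simp add: cap_eq)
  then show ?thesis
    by (simp add: neg_neg closed)
qed

text \<open>The law comes from \<open>z = \<one>\<close>. Conversely, orthomodularity at
  \<open>x \<sqinter> y\<close> in place of \<open>y\<close> becomes the quantum identity once the
  law rewrites \<open>x \<rightarrow> (x \<sqinter> y)\<close>.\<close>

lemma quantum_wajsberg_iff_imp_cap_left:
  "quantum_wajsberg_algebra X imp zero one \<longleftrightarrow> (\<forall>x\<in>X. \<forall>y\<in>X. x \<rightarrow> (x \<sqinter> y) = x \<rightarrow> y)"
proof
  assume "quantum_wajsberg_algebra X imp zero one"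
  then interpret quantum_wajsberg_algebra X imp zero one .
  show "\<forall>x\<in>X. \<forall>y\<in>X. x \<rightarrow> (x \<sqinter> y) = x \<rightarrow> y"
  proof (intro ballI)
    fix x y assume [simp]: "x \<in> X" "y \<in> X"
    have "x \<rightarrow> ((x \<sqinter> y) \<sqinter> x) = x \<rightarrow> y"
      using quantum_wajsberg[of x y \<one>] by (simp add: one_cap cap_one imp_one closed)
    then show "x \<rightarrow> (x \<sqinter> y) = x \<rightarrow> y"
      by (simp add: imp_cap closed)
  qed
next
  assume "\<forall>x\<in>X. \<forall>y\<in>X. x \<rightarrow> (x \<sqinter> y) = x \<rightarrow> y"
  then show "quantum_wajsberg_algebra X imp zero one"
    by unfold_locales (simp add: implicative_orthomodular closed)
qed

lemma meta_wajsberg_iff_imp_cap_left: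
  "meta_wajsberg_algebra X imp zero one \<longleftrightarrow> (\<forall>x\<in>X. \<forall>y\<in>X. x \<rightarrow> (x \<sqinter> y) = x \<rightarrow> y)"
proof
  assume "meta_wajsberg_algebra X imp zero one"
  then interpret meta_wajsberg_algebra X imp zero one .
  show "\<forall>x\<in>X. \<forall>y\<in>X. x \<rightarrow> (x \<sqinter> y) = x \<rightarrow> y"
  proof (intro ballI)
    fix x y assume [simp]: "x \<in> X" "y \<in> X"
    let ?p = "x \<sqinter> y" and ?q = "y \<sqinter> x"
    let ?u = "x \<rightarrow> y" and ?v = "x \<rightarrow> ?p"
    have "?p \<sqinter> ?q = ?q"
      by (simp add: cap_eq_right meta_wajsberg closed)
    then have "?u = ?v \<sqinter> ?u"
      using implicative_orthomodular[of x ?p y] by (simp add: imp_cap closed)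
    also have "?u = (y \<rightarrow> x) \<rightarrow> ?v"
      using imp_imp_cap[of y x] imp_exchange[of "y \<rightarrow> x" x ?p] by (simp add: closed)
    then have "?v \<sqinter> ?u = ?v"
      using cap_imp_cancel[of ?v "y \<rightarrow> x"] by (simp add: closed)
    finally show "?v = ?u" by simp
  qed
next
  assume "\<forall>x\<in>X. \<forall>y\<in>X. x \<rightarrow> (x \<sqinter> y) = x \<rightarrow> y"
  \<comment> \<open>Residuation gives \<open>(y \<rightarrow> x) \<rightarrow> (y \<rightarrow> (y
    \<sqinter> x))\<close>, which the law with \<open>x\<close> and \<open>y\<close> swapped reduces
    to reflexivity.\<close>
  then show "meta_wajsberg_algebra X imp zero one"
    by unfold_locales (simp add: cap_imp imp_refl closed)
qed

end

theorem theorem3p13: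
  fixes X :: "'a set"
    and imp :: "'a \<Rightarrow> 'a \<Rightarrow> 'a"
    and zero one :: 'a
  assumes "implicative_orthomodular_algebra X imp zero one"
  shows "quantum_wajsberg_algebra X imp zero one \<longleftrightarrow> meta_wajsberg_algebra X imp zero one"
proof -
  interpret implicative_orthomodular_algebra X imp zero one by fact
  show ?thesis
    by (simp add: quantum_wajsberg_iff_imp_cap_left meta_wajsberg_iff_imp_cap_left)
qed

end
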